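(* Let $T, D \ge 1$ be integers, let $s_0 \in \mathbb{R}^D$, and let $f_1,\dots,f_T : \mathbb{R}^D \to \mathbb{R}^D$ be differentiable with Jacobians $J_t(s) = \frac{\partial f_t}{\partial s}(s)$, and suppose that for some $L > 0$, $\|J_t(s) - J_t(s')\|_2 \le L \|s - s'\|_2$ for all $1 < t \le T$ and $s,s' \in \mathbb{R}^D$. Let $\mathbf{r}$ be the residual function, $\mathbf{J}$ its Jacobian, and suppose $\mu := \inf_{\mathbf{s} \in \mathbb{R}^{TD}} \sigma_{\min}^2(\mathbf{J}(\mathbf{s})) > 0$. Let $(\mathbf{s}^{(i)})_{i \ge 0}$ be the DEER (Gauss–Newton) iterates $\mathbf{s}^{(i+1)} = \mathbf{s}^{(i)} - \mathbf{J}(\mathbf{s}^{(i)})^{-1} \mathbf{r}(\mathbf{s}^{(i)})$ from an arbitrary $\mathbf{s}^{(0)} \in \mathbb{R}^{TD}$. (1) If $$ \| \mathbf{r}(\mathbf{s}^{(i)}) \|_2 \ <\ \frac{2\mu}{L}, $$ then $\mathbf{s}^{(i)}$ is inside the basin of quadratic convergence of DEER. (2) Suppose in addition that there are constants $\lambda \in \mathbb{R}\setminus\{0\}$, $a \ge 1$, $0 < b \le 1$ such that, for all $t > 1$, all $k \ge 0$ with $t+k-1 \le T$, and all $\mathbf{s} = \operatorname{vec}(s_1,\dots,s_T) \in \mathbb{R}^{TD}$, writing $J_t = J_t(s_{t-1})$, $$ b\, e^{\lambda k} \ \le\ \| J_{t+k-1} J_{t+k-2} \cdots J_t \|_2 \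 \le\ a\, e^{\lambda k}$$ (the product being the identity for $k=0$). If $$ \| \mathbf{r}(\mathbf{s}^{(i)}) \|_2 \ <\ \frac{2}{a^2 L} \cdot \left( \frac{e^{\lambda} - 1}{e^{\lambda T} - 1} \right)^2, $$ then $\mathbf{s}^{(i)}$ is inside the basin of quadratic convergence of DEER.
   Context: Consider the nonlinear state space model $s_t = f_t(s_{t-1}) \in \mathbb{R}^D$, $t=1,\dots,T$, with fixed initial condition $s_0$. The residual function is $$\mathbf{r}(\mathbf{s}) = \operatorname{vec}\big([s_1 - f_1(s_0), \ldots, s_T - f_T(s_{T-1})]\big) \in \mathbb{R}^{TD}, \qquad \mathbf{s} = \operatorname{vec}(s_1,\dots,s_T) \in \mathbb{R}^{TD},$$ where $\operatorname{vec}$ stacks vectors into one column. Its Jacobian $\mathbf{J}(\mathbf{s}) = \frac{\partial \mathbf{r}}{\partial \mathbf{s}}(\mathbf{s})$ is block bidiagonal with $D\times D$ blocks: its diagonal blocks are $I_D$, its block in block-row $t$ and block-column $t-1$ is $-J_t(s_{t-1})$ for $t=2,\dots,T$, and all other blocks are zero; in particular it is invertible. The merit function is $\mathcal{L}(\mathbf{s}) = \frac12\|\mathbf{r}(\mathbf{s})\|_2^2$, and $\mu$ is its Polyak–Łojasiewicz (PL) constant. $\sigma_{\min}$ is the smallest singular value; $\|\cdot\|_2$ is the Euclidean norm of vectors and the spectral norm of matrices. The number $\lambda$ plays the role of the Largest Lyapunov Exponent of the model. Basin of quadratic convergence: $\mathbf{s}^{(i)}$ is said to be inside the basin of quadratic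 convergence of DEER if, for all $j \ge i$, $\|\mathbf{r}(\mathbf{s}^{(j+1)})\|_2 \le \frac{L}{2\mu} \|\mathbf{r}(\mathbf{s}^{(j)})\|_2^2$, with $\|\mathbf{r}(\mathbf{s}^{(j+1)})\|_2 < \|\mathbf{r}(\mathbf{s}^{(j)})\|_2$ whenever $\mathbf{r}(\mathbf{s}^{(j)}) \ne 0$, and $\|\mathbf{r}(\mathbf{s}^{(j)})\|_2 \to 0$ as $j \to \infty$. *)

theory Defs
  imports "HOL-Analysis.Analysis"
begin

text \<open>
  The space of stacked trajectories, of dimension T D, is \<open>real ^ ('t \<times> 'd)\<close>, where \<open>'d\<close> has D
  elements and \<open>'t\<close> has T elements. The time steps 1, ..., T are attached to the elements of \<open>'t\<close> by
  a numbering \<open>e\<close> with \<open>bij_betw e {1..T} UNIV\<close>; everything below is meant for such an \<open>e\<close>.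
\<close>

definition stack ::
  "nat \<Rightarrow> (nat \<Rightarrow> 't::finite) \<Rightarrow> (nat \<Rightarrow> real ^ 'd::finite) \<Rightarrow> real ^ ('t \<times> 'd)" where
  "stack T e v = (\<chi> p. v (the_inv_into {1..T} e (fst p)) $ snd p)"

definition state ::
  "(nat \<Rightarrow> 't::finite) \<Rightarrow> real ^ 'd::finite \<Rightarrow> real ^ ('t \<times> 'd) \<Rightarrow> nat \<Rightarrow> real ^ 'd" where
  "state e s0 s t = (if t = 0 then s0 else (\<chi> k. s $ (e t, k)))"

lemma state_stack:
  assumes "bij_betw e {1..T} UNIV" and "t \<in> {1..T}"
  shows "state e s0 (stack T e v) t = v t"
  using assms
  by (auto simp: state_def stack_def vec_eq_iff bij_betw_def the_inv_into_f_f)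

lemma stack_state:
  assumes "bij_betw e {1..T} UNIV"
  shows "stack T e (state e s0 s) = s"
proof -
  have "the_inv_into {1..T} e i \<in> {1..T}" "e (the_inv_into {1..T} e i) = i" for i
    using assms the_inv_into_into[of e "{1..T}" i "{1..T}"] f_the_inv_into_f[of e "{1..T}" i]
    by (auto simp: bij_betw_def)
  moreover from this(1) have "the_inv_into {1..T} e i \<noteq> 0" for i
    by (metis atLeastAtMost_iff not_one_le_zero)
  ultimately show ?thesis
    by (simp add: state_def stack_def vec_eq_iff del: neq0_conv)
qed

definition residual ::
  "nat \<Rightarrow> (nat \<Rightarrow> 't::finite) \<Rightarrow> (nat \<Rightarrow> real ^ 'd \<Rightarrow> real ^ 'd::finite) \<Rightarrow> real ^ 'd
     \<Rightarrow> real ^ ('t \<times> 'd) \<Rightarrow> real ^ ('t \<times> 'd)" where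
  "residual T e f s0 s = stack T e (\<lambda>t. state e s0 s t - f t (state e s0 s (t - 1)))"

definition jac :: "(real ^ 'n::finite \<Rightarrow> real ^ 'm::finite) \<Rightarrow> real ^ 'n \<Rightarrow> real ^ 'n ^ 'm" where
  "jac g x = jacobian g (at x)"

definition spectral_norm :: "real ^ 'n::finite ^ 'm::finite \<Rightarrow> real" where
  "spectral_norm A = onorm (\<lambda>x. A *v x)"

definition singular_values :: "real ^ 'n::finite ^ 'm::finite \<Rightarrow> real set" where
  "singular_values A =
     {\<sigma>. 0 \<le> \<sigma> \<and> (\<exists>v. v \<noteq> 0 \<and> (transpose A ** A) *v v = \<sigma>\<^sup>2 *\<^sub>R v)}"

definition sigma_min :: "real ^ 'n::finite ^ 'm::finite \<Rightarrow> real" where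
  "sigma_min A = (LEAST \<sigma>. \<sigma> \<in> singular_values A)"

text \<open>\<open>mat_prod A t k\<close> is the product \<open>A (t + k - 1) ** \<dots> ** A t\<close> of k factors.\<close>

primrec mat_prod :: "(nat \<Rightarrow> real ^ 'd ^ 'd) \<Rightarrow> nat \<Rightarrow> nat \<Rightarrow> real ^ 'd ^ 'd::finite" where
  "mat_prod A t 0 = mat 1"
| "mat_prod A t (Suc k) = A (t + k) ** mat_prod A t k"

definition deer_iterates ::
  "(real ^ 'n \<Rightarrow> real ^ 'n) \<Rightarrow> (nat \<Rightarrow> real ^ 'n::finite) \<Rightarrow> bool" where
  "deer_iterates r s \<longleftrightarrow> (\<forall>i. s (Suc i) = s i - matrix_inv (jac r (s i)) *v r (s i))"

definition in_quadratic_basin ::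
  "real \<Rightarrow> real \<Rightarrow> (real ^ 'n \<Rightarrow> real ^ 'n) \<Rightarrow> (nat \<Rightarrow> real ^ 'n::finite) \<Rightarrow> nat \<Rightarrow> bool" where
  "in_quadratic_basin L \<mu> r s i \<longleftrightarrow>
     (\<forall>j\<ge>i. norm (r (s (Suc j))) \<le> L / (2 * \<mu>) * (norm (r (s j)))\<^sup>2 \<and>
             (r (s j) \<noteq> 0 \<longrightarrow> norm (r (s (Suc j))) < norm (r (s j)))) \<and>
     (\<lambda>j. norm (r (s j))) \<longlonglongrightarrow> 0"

end

theory Submission
  imports Defs
begin

text \<open>
  Each DEER iteration is an exact Newton step for the square system \<open>r x = 0\<close>, so the linear part of
  the residual at the current iterate is cancelled and the next residual is precisely the
  second-order Taylor remainder of \<open>r\<close> along the step \<open>v\<close>. Two estimates control it.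

  The remainder is at most \<open>L / 2 * (norm v)\<^sup>2\<close> (\<open>residual_taylor\<close>). The nonlinear part of block \<open>t\<close> of
  the residual depends only on block \<open>t - 1\<close> of the trajectory, so the Taylor bounds of the
  individual maps \<open>f t\<close> add up over the blocks without loss; block 1 contributes nothing, since it
  sees only the fixed initial state.

  The step satisfies \<open>\<mu> * (norm v)\<^sup>2 \<le> (norm (r x))\<^sup>2\<close>, because the smallest singular value of a
  matrix is the minimum of \<open>norm (A *v v) / norm v\<close> (\<open>sigma_min_attained\<close>).

  Together they give \<open>norm (r x') \<le> L / (2 * \<mu>) * (norm (r x))\<^sup>2\<close> for a step from \<open>x\<close> to \<open>x'\<close>
  (\<open>newton_step_quadratic\<close>). Once the residual is below \<open>2 * \<mu> / L\<close>, this recursion contracts with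
  a ratio \<open>q < 1\<close>, which is the first claim (\<open>in_quadratic_basinI\<close>).

  The second claim reduces to the first by a lower bound on \<open>\<mu>\<close>. Solving \<open>J v = w\<close> by forward
  substitution expresses each block of \<open>v\<close> as a causal convolution of the blocks of \<open>w\<close> with products
  of Jacobians (\<open>forward_substitution\<close>). The growth bound on those products and Young's convolution
  inequality yield \<open>norm v \<le> a * G * norm w\<close>, where \<open>G\<close> is the geometric sum
  \<open>(exp (lam * T) - 1) / (exp lam - 1)\<close>. Hence \<open>\<mu> \<ge> 1 / (a * G)\<^sup>2\<close>, and the assumed bound on the
  residual implies the one of the first claim.
\<close>

section \<open>The smallest singular value\<close>

lemma inner_transpose_mult_self:
  fixes A :: "real ^ 'n::finite ^ 'm::finite"
  shows "((transpose A ** A) *v v) \<bullet> w = (A *v v) \<bullet> (A *v w)"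
  by (metis dot_lmul_matrix matrix_vector_mul_assoc transpose_matrix_vector transpose_transpose)

text \<open>
  The minimum \<open>m\<close> of \<open>norm (A *v v)\<close> over the unit sphere exists by compactness. A minimiser \<open>u\<close> is an
  eigenvector of \<open>transpose A ** A\<close>: the positive semidefinite form
  \<open>(norm (A *v v))\<^sup>2 - m\<^sup>2 * (norm v)\<^sup>2\<close> vanishes at \<open>u\<close>, so its gradient there must vanish too.
  Thus \<open>m\<close> is a singular value, and evaluating the norm at any other eigenvector shows that no
  singular value is smaller; in particular the least singular value exists.
\<close>

lemma sigma_min_attained:
  fixes A :: "real ^ 'n::finite ^ 'm::finite"
  shows "0 \<le> sigma_min A"
    and "\<And>v. sigma_min A * norm v \<le> norm (A *v v)"
    and "\<exists>v. v \<noteq> 0 \<and> norm (A *v v) = sigma_min A * norm v"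
proof -
  have "continuous_on (sphere 0 1) (\<lambda>v. norm (A *v v))"
    by (intro continuous_intros linear_continuous_on matrix_vector_mul_bounded_linear)
  moreover have "sphere (0::real ^ 'n) 1 \<noteq> {}"
    by (simp add: sphere_eq_empty)
  ultimately obtain u where u: "norm u = 1"
    and u_min: "\<And>v. norm v = 1 \<Longrightarrow> norm (A *v u) \<le> norm (A *v v)"
    using continuous_attains_inf[OF compact_sphere, of 0 1 "\<lambda>v. norm (A *v v)"] by auto
  define m where "m = norm (A *v u)"
  have m0: "0 \<le> m" by (simp add: m_def)
  have lower: "m * norm v \<le> norm (A *v v)" for v
  proof (cases "v = 0")
    case False
    then have "m \<le> norm (A *v ((1 / norm v) *\<^sub>R v))"
      unfolding m_def by (intro u_min) simp
    also have "\<dots> = norm (A *v v) / norm v"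
      by (simp add: matrix_vector_mult_scaleR)
    finally show ?thesis using False by (simp add: field_simps)
  qed simp
  \<comment> \<open>\<open>z\<close> is half the gradient of the form at \<open>u\<close>; a small step from \<open>u\<close> along \<open>- z\<close> would make
    the form negative unless \<open>z = 0\<close>.\<close>
  define z where "z = (transpose A ** A) *v u - m\<^sup>2 *\<^sub>R u"
  have zero: "z = 0"
  proof (rule ccontr)
    assume "z \<noteq> 0"
    define q where "q = (norm (A *v z))\<^sup>2 - m\<^sup>2 * (norm z)\<^sup>2"
    have quad: "0 \<le> 2 * t * (norm z)\<^sup>2 + t\<^sup>2 * q" for t
    proof -
      have "(m * norm (u + t *\<^sub>R z))\<^sup>2 \<le> (norm (A *v (u + t *\<^sub>R z)))\<^sup>2"
        by (intro power_mono lower) (simp add: m0)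
      moreover have "(norm (u + t *\<^sub>R z))\<^sup>2 = 1 + 2 * t * (u \<bullet> z) + t\<^sup>2 * (norm z)\<^sup>2"
        using u unfolding power2_norm_eq_inner norm_eq_1
        by (simp add: inner_simps inner_commute power2_eq_square algebra_simps)
      moreover have "(norm (A *v (u + t *\<^sub>R z)))\<^sup>2 =
          m\<^sup>2 + 2 * t * ((A *v u) \<bullet> (A *v z)) + t\<^sup>2 * (norm (A *v z))\<^sup>2"
        unfolding m_def power2_norm_eq_inner matrix_vector_right_distrib matrix_vector_mult_scaleR
        by (simp add: inner_add_left inner_add_right inner_commute power2_eq_square algebra_simps)
      ultimately have le: "m\<^sup>2 * (1 + 2 * t * (u \<bullet> z) + t\<^sup>2 * (norm z)\<^sup>2) \<le>
          m\<^sup>2 + 2 * t * ((A *v u) \<bullet> (A *v z)) + t\<^sup>2 * (norm (A *v z))\<^sup>2"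
        by (simp only: power_mult_distrib)
      have "(norm z)\<^sup>2 = (A *v u) \<bullet> (A *v z) - m\<^sup>2 * (u \<bullet> z)"
        unfolding inner_transpose_mult_self[symmetric]
        by (subst power2_norm_eq_inner, subst (1) z_def) (simp add: inner_simps)
      then have eq: "2 * t * (norm z)\<^sup>2 = 2 * t * ((A *v u) \<bullet> (A *v z)) - 2 * t * (m\<^sup>2 * (u \<bullet> z))"
        by (simp only: right_diff_distrib)
      show ?thesis
        using le unfolding q_def eq by (simp add: algebra_simps)
    qed
    have z2: "0 < (norm z)\<^sup>2" using \<open>z \<noteq> 0\<close> by simp
    \<comment> \<open>The step is so short that the quadratic term cancels at most half of the linear one; the
      summand 1 keeps the denominator positive.\<close>
    define t where "t = - (norm z)\<^sup>2 / (\<bar>q\<bar> + 1)"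
    have "t\<^sup>2 * q \<le> t\<^sup>2 * (\<bar>q\<bar> + 1)" by (intro mult_left_mono) auto
    also have "\<dots> = t * (t * (\<bar>q\<bar> + 1))" by (simp add: power2_eq_square)
    also have "t * (\<bar>q\<bar> + 1) = - (norm z)\<^sup>2" by (simp add: t_def)
    finally have "0 \<le> t * (norm z)\<^sup>2" using quad[of t] by linarith
    moreover have "t < 0" using z2 by (simp add: t_def field_simps add_nonneg_pos)
    ultimately show False using z2 by (simp add: zero_le_mult_iff)
  qed
  have "sigma_min A = m"
    unfolding sigma_min_def
  proof (rule Least_equality)
    show "m \<in> singular_values A"
      using zero u m0 by (auto simp: singular_values_def z_def intro!: exI[of _ u])
  next
    fix \<sigma> assume "\<sigma> \<in> singular_values A"
    then obtain v where v: "0 \<le> \<sigma>" "v \<noteq> 0" "(transpose A ** A) *v v = \<sigma>\<^sup>2 *\<^sub>R v"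
      by (auto simp: singular_values_def)
    have "(norm (A *v v))\<^sup>2 = (\<sigma> * norm v)\<^sup>2"
      using inner_transpose_mult_self[of A v v] v(3)
      by (simp add: power2_norm_eq_inner power_mult_distrib)
    then have "norm (A *v v) = \<sigma> * norm v" using v(1) by simp
    then show "m \<le> \<sigma>" using lower[of v] v(2) by simp
  qed
  then show "0 \<le> sigma_min A" "\<And>v. sigma_min A * norm v \<le> norm (A *v v)"
    "\<exists>v. v \<noteq> 0 \<and> norm (A *v v) = sigma_min A * norm v"
    using m0 lower u by (auto intro!: exI[of _ u] simp: m_def)
qed

section \<open>Newton steps\<close>

text \<open>
  The derivative of \<open>t \<mapsto> g (x + t v) - t g'(x) v\<close> is bounded by \<open>L t (norm v)\<^sup>2\<close>, so the mean value
  inequality against the primitive \<open>L / 2 * t\<^sup>2 * (norm v)\<^sup>2\<close> gives the factor 1/2.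
\<close>

lemma taylor_remainder_lipschitz_derivative:
  fixes g :: "'a::real_normed_vector \<Rightarrow> 'b::real_normed_vector"
  assumes deriv: "\<And>x. (g has_derivative g' x) (at x)"
    and lip: "\<And>x y. norm (g' x v - g' y v) \<le> L * norm (x - y) * norm v"
  shows "norm (g (x + v) - g x - g' x v) \<le> L / 2 * (norm v)\<^sup>2"
proof -
  define \<phi> where "\<phi> = (\<lambda>t::real. g (x + t *\<^sub>R v) - t *\<^sub>R g' x v)"
  define \<psi> where "\<psi> = (\<lambda>t::real. L / 2 * (norm v)\<^sup>2 * t\<^sup>2)"
  have \<phi>': "(\<phi> has_vector_derivative g' (x + t *\<^sub>R v) v - g' x v) (at t)" for t
  proof -
    have "((\<lambda>t. g (x + t *\<^sub>R v)) has_derivative (\<lambda>h. g' (x + t *\<^sub>R v) (h *\<^sub>R v))) (at t)"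
      by (rule has_derivative_compose[OF _ deriv]) (auto intro!: derivative_eq_intros)
    moreover have "g' (x + t *\<^sub>R v) (h *\<^sub>R v) = h *\<^sub>R g' (x + t *\<^sub>R v) v" for h
      using has_derivative_linear[OF deriv] by (rule linear_scale)
    ultimately have "((\<lambda>t. g (x + t *\<^sub>R v)) has_vector_derivative g' (x + t *\<^sub>R v) v) (at t)"
      by (simp add: has_vector_derivative_def)
    then show ?thesis
      unfolding \<phi>_def by (auto intro!: derivative_eq_intros)
  qed
  have \<psi>': "(\<psi> has_vector_derivative L * (norm v)\<^sup>2 * t) (at t)" for t
    unfolding \<psi>_def has_real_derivative_iff_has_vector_derivative[symmetric]
    by (auto intro!: derivative_eq_intros)
  have "norm (\<phi> 1 - \<phi> 0) \<le> \<psi> 1 - \<psi> 0"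
  proof (rule differentiable_bound_general[OF zero_less_one _ _ \<phi>' \<psi>'])
    show "continuous_on {0..1} \<phi>" "continuous_on {0..1} \<psi>"
      using \<phi>' \<psi>' by (auto intro!: continuous_at_imp_continuous_on has_vector_derivative_continuous)
    fix t :: real assume "0 < t"
    then show "norm (g' (x + t *\<^sub>R v) v - g' x v) \<le> L * (norm v)\<^sup>2 * t"
      using lip[of "x + t *\<^sub>R v" x] by (simp add: power2_eq_square mult_ac)
  qed
  then show ?thesis by (simp add: \<phi>_def \<psi>_def algebra_simps)
qed

text \<open>
  The Newton direction \<open>v\<close> solves \<open>A *v v = - r x\<close>, so the Taylor remainder is the whole new residual,
  while the smallest singular value bounds \<open>norm v\<close> by \<open>norm (r x) / sqrt \<mu>\<close>.
\<close>

lemma newton_step_quadratic: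
  fixes r :: "real ^ 'n::finite \<Rightarrow> real ^ 'n"
  assumes taylor: "\<And>v. norm (r (x + v) - r x - A *v v) \<le> L / 2 * (norm v)\<^sup>2"
    and "0 < L" "0 < \<mu>" and \<mu>: "\<mu> \<le> (sigma_min A)\<^sup>2"
  shows "norm (r (x - matrix_inv A *v r x)) \<le> L / (2 * \<mu>) * (norm (r x))\<^sup>2"
proof -
  have "0 < sigma_min A"
    using \<mu> \<open>0 < \<mu>\<close> sigma_min_attained(1)[of A] by (cases "sigma_min A = 0") auto
  then have "\<exists>B. B ** A = mat 1"
    unfolding matrix_left_invertible_ker
    using sigma_min_attained(2)[of A] by (metis mult_le_0_iff norm_le_zero_iff norm_zero not_less)
  then have "invertible A" by (simp add: invertible_left_inverse)
  then have inv: "A ** matrix_inv A = mat 1"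
    unfolding invertible_def matrix_inv_def by (rule conjunct1[OF someI_ex])
  define v where "v = - (matrix_inv A *v r x)"
  have Av: "A *v v = - r x"
    by (simp add: v_def linear_neg[OF matrix_vector_mul_linear] matrix_vector_mul_assoc inv)
  have "\<mu> * (norm v)\<^sup>2 \<le> (sigma_min A * norm v)\<^sup>2"
    using \<mu> by (simp add: power_mult_distrib mult_right_mono)
  also have "\<dots> \<le> (norm (A *v v))\<^sup>2"
    using sigma_min_attained(1,2)[of A] by (intro power_mono) auto
  also have "\<dots> = (norm (r x))\<^sup>2"
    by (simp add: Av)
  finally have v2: "(norm v)\<^sup>2 \<le> (norm (r x))\<^sup>2 / \<mu>"
    using \<open>0 < \<mu>\<close> by (simp add: field_simps)
  have "norm (r (x + v)) \<le> L / 2 * (norm v)\<^sup>2"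
    using taylor[of v] Av by simp
  also have "\<dots> \<le> L / 2 * ((norm (r x))\<^sup>2 / \<mu>)"
    using v2 \<open>0 < L\<close> by (intro mult_left_mono) auto
  finally show ?thesis by (simp add: v_def)
qed

text \<open>
  With \<open>C = L / (2 * \<mu>)\<close> the recursion reads \<open>\<rho>' \<le> (C * \<rho>) * \<rho>\<close>. The factor \<open>C * \<rho>\<close> starts below 1 and
  never exceeds its initial value \<open>q\<close>, so the residual norms decay at least geometrically.
\<close>

lemma in_quadratic_basinI:
  assumes step: "\<And>j. norm (r (s (Suc j))) \<le> L / (2 * \<mu>) * (norm (r (s j)))\<^sup>2"
    and "0 < L" "0 < \<mu>" and start: "norm (r (s i)) < 2 * \<mu> / L"
  shows "in_quadratic_basin L \<mu> r s i"
proof -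
  define C where "C = L / (2 * \<mu>)"
  define q where "q = C * norm (r (s i))"
  have C: "0 < C" using assms by (simp add: C_def)
  have q: "0 \<le> q" "q < 1"
    using start assms(2,3) C by (auto simp: q_def C_def field_simps)
  have contract: "norm (r (s (Suc (i + k)))) \<le> q * norm (r (s (i + k)))"
    if "norm (r (s (i + k))) \<le> norm (r (s i))" for k
  proof -
    have "C * norm (r (s (i + k))) \<le> q"
      unfolding q_def using that C by (intro mult_left_mono) auto
    then have "C * norm (r (s (i + k))) * norm (r (s (i + k))) \<le> q * norm (r (s (i + k)))"
      by (intro mult_right_mono) auto
    with step[of "i + k"] show ?thesis
      by (simp add: C_def power2_eq_square mult_ac)
  qed
  have geom: "norm (r (s (i + k))) \<le> norm (r (s i)) * q ^ k" for k
  proof (induction k)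
    case (Suc k)
    have "norm (r (s i)) * q ^ k \<le> norm (r (s i)) * 1"
      using q by (intro mult_left_mono power_le_one) auto
    with Suc have "norm (r (s (i + Suc k))) \<le> q * norm (r (s (i + k)))"
      using contract[of k] by simp
    also have "\<dots> \<le> q * (norm (r (s i)) * q ^ k)"
      using Suc q by (intro mult_left_mono) auto
    finally show ?case by (simp add: mult_ac)
  qed simp
  have below: "norm (r (s (i + k))) \<le> norm (r (s i))" for k
  proof -
    have "norm (r (s i)) * q ^ k \<le> norm (r (s i)) * 1"
      using q by (intro mult_left_mono power_le_one) auto
    with geom[of k] show ?thesis by simp
  qed
  have "norm (r (s (Suc j))) < norm (r (s j))" if "i \<le> j" "r (s j) \<noteq> 0" for j
  proof -
    have "norm (r (s (Suc j))) \<le> q * norm (r (s j))"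
      using contract[OF below, of "j - i"] that(1) by simp
    also have "\<dots> < 1 * norm (r (s j))"
      using that(2) q by (intro mult_strict_right_mono) auto
    finally show ?thesis by simp
  qed
  moreover have "(\<lambda>k. norm (r (s (k + i)))) \<longlonglongrightarrow> 0"
  proof (rule tendsto_sandwich[OF _ _ tendsto_const])
    show "(\<lambda>k. norm (r (s i)) * q ^ k) \<longlonglongrightarrow> 0"
      using q by (intro tendsto_mult_right_zero LIMSEQ_realpow_zero) auto
  qed (use geom in \<open>auto simp: add.commute\<close>)
  then have "(\<lambda>j. norm (r (s j))) \<longlonglongrightarrow> 0"
    by (rule LIMSEQ_offset)
  ultimately show ?thesis
    using step by (simp add: in_quadratic_basin_def)
qed

section \<open>Stacked trajectories and the residual\<close>

lemma norm_stack:
  fixes e :: "nat \<Rightarrow> 't::finite" and v :: "nat \<Rightarrow> real ^ 'd::finite"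
  assumes e: "bij_betw e {1..T} UNIV"
  shows "norm (stack T e v) = L2_set (\<lambda>t. norm (v t)) {1..T}"
proof -
  have "(\<Sum>p\<in>UNIV. (stack T e v $ p)\<^sup>2) =
      (\<Sum>i\<in>UNIV. \<Sum>k\<in>UNIV. (v (the_inv_into {1..T} e i) $ k)\<^sup>2)"
    by (simp add: stack_def sum.cartesian_product case_prod_unfold)
  also have "\<dots> = (\<Sum>t=1..T. \<Sum>k\<in>UNIV. (v (the_inv_into {1..T} e (e t)) $ k)\<^sup>2)"
    by (rule sum.reindex_bij_betw[OF e, symmetric])
  also have "\<dots> = (\<Sum>t=1..T. (norm (v t))\<^sup>2)"
    using e by (intro sum.cong)
      (auto simp: bij_betw_def the_inv_into_f_f norm_vec_def L2_set_def sum_nonneg)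
  finally show ?thesis by (simp add: norm_vec_def L2_set_def)
qed

lemma norm_eq_L2_set_state:
  assumes "bij_betw e {1..T} UNIV"
  shows "norm x = L2_set (\<lambda>t. norm (state e s0 x t)) {1..T}"
  using norm_stack[OF assms, of "state e s0 x"] by (simp add: stack_state[OF assms])

text \<open>
  A perturbation of a trajectory leaves the initial state alone, so its blocks are read off with
  initial state 0. This makes the formulas below uniform in \<open>t\<close>, including \<open>t = 1\<close>.
\<close>

lemma state_add: "state e s0 (x + v) t = state e s0 x t + state e 0 v t"
  by (simp add: state_def vec_eq_iff)

lemma has_derivative_cart_componentwise:
  fixes g :: "'a::real_normed_vector \<Rightarrow> real ^ 'n::finite"
  assumes "\<And>i. ((\<lambda>x. g x $ i) has_derivative (\<lambda>h. g' h $ i)) (at x)"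
  shows "(g has_derivative g') (at x)"
  using assms
  by (subst has_derivative_componentwise_within) (auto simp: Basis_vec_def inner_axis)

lemma has_derivative_state:
  "((\<lambda>x. state e s0 x t) has_derivative (\<lambda>v. state e 0 v t)) (at x)"
proof (cases "t = 0")
  case False
  have "((\<lambda>x. x $ (e t, k)) has_derivative (\<lambda>v. v $ (e t, k))) (at x)" for k
    by (intro bounded_linear_imp_has_derivative bounded_linear_vec_nth)
  with False show ?thesis
    by (intro has_derivative_cart_componentwise) (simp add: state_def)
qed (simp add: state_def)

lemma jac_eqI:
  assumes "(g has_derivative (\<lambda>v. g' v)) (at x)"
  shows "jac g x *v v = g' v"
proof -
  have "(g has_derivative (\<lambda>v. jac g x *v v)) (at x)"
    unfolding jac_def jacobian_works[symmetric]
    using assms by (rule differentiableI)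
  from has_derivative_unique[OF this assms] show ?thesis by metis
qed

lemma has_derivative_jac:
  assumes "g differentiable (at x)"
  shows "(g has_derivative (\<lambda>v. jac g x *v v)) (at x)"
  using assms unfolding jac_def jacobian_works .

text \<open>
  This is the block bidiagonal form of the Jacobian. At \<open>t = 1\<close> the subtracted term is zero because
  \<open>state e 0 v 0 = 0\<close>, in accordance with the missing block to the left of the first diagonal block.
\<close>

lemma jac_residual:
  fixes e :: "nat \<Rightarrow> 't::finite" and f :: "nat \<Rightarrow> real ^ 'd::finite \<Rightarrow> real ^ 'd"
  assumes e: "bij_betw e {1..T} UNIV"
    and diff: "\<And>t x. 1 \<le> t \<Longrightarrow> t \<le> T \<Longrightarrow> f t differentiable (at x)"
  shows "jac (residual T e f s0) x *v v =
    stack T e (\<lambda>t. state e 0 v t - jac (f t) (state e s0 x (t - 1)) *v state e 0 v (t - 1))"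
proof (rule jac_eqI, rule has_derivative_cart_componentwise)
  fix p :: "'t \<times> 'd"
  define t where "t = the_inv_into {1..T} e (fst p)"
  have "t \<in> {1..T}"
    using e the_inv_into_into[of e "{1..T}" "fst p" "{1..T}"] by (auto simp: bij_betw_def t_def)
  then have "f t differentiable (at y)" for y using diff by simp
  then have "((\<lambda>x. f t (state e s0 x (t - 1))) has_derivative
      (\<lambda>v. jac (f t) (state e s0 x (t - 1)) *v state e 0 v (t - 1))) (at x)"
    by (intro has_derivative_compose[OF has_derivative_state] has_derivative_jac)
  then show "((\<lambda>x. residual T e f s0 x $ p) has_derivative
      (\<lambda>v. stack T e (\<lambda>t. state e 0 v t - jac (f t) (state e s0 x (t - 1)) *v state e 0 v (t - 1)) $ p))
      (at x)"
    unfolding residual_def stack_def vec_lambda_beta t_def[symmetric]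
    by (intro bounded_linear.has_derivative[OF bounded_linear_vec_nth] has_derivative_diff
        has_derivative_state)
qed

lemma L2_set_power2_le: "L2_set (\<lambda>t. (u t)\<^sup>2) S \<le> (L2_set u S)\<^sup>2"
proof (cases "finite S")
  case True
  have "(L2_set (\<lambda>t. (u t)\<^sup>2) S)\<^sup>2 = (\<Sum>t\<in>S. (u t)\<^sup>2 * (u t)\<^sup>2)"
    by (simp add: L2_set_def sum_nonneg power2_eq_square)
  also have "\<dots> \<le> (\<Sum>t\<in>S. (u t)\<^sup>2 * (\<Sum>t\<in>S. (u t)\<^sup>2))"
    using True by (intro sum_mono mult_left_mono member_le_sum) auto
  also have "\<dots> = ((L2_set u S)\<^sup>2)\<^sup>2"
    by (simp add: L2_set_def sum_nonneg power2_eq_square sum_distrib_right)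
  finally show ?thesis by (rule power2_le_imp_le) simp
qed simp

text \<open>
  Block \<open>t\<close> of the remainder is minus the Taylor remainder of \<open>f t\<close>, of size at most
  \<open>L / 2 * (norm (V (t - 1)))\<^sup>2\<close>. The \<open>\<ell>\<^sup>2\<close> norm of the squares is at most the square of the \<open>\<ell>\<^sup>2\<close> norm,
  which is why the blockwise constant \<open>L / 2\<close> survives for the stacked residual.
\<close>

text \<open>
  Delaying a signal within a finite window can only push some of its energy out of the window.
\<close>

lemma L2_set_shift_le:
  fixes u :: "nat \<Rightarrow> real"
  shows "L2_set (\<lambda>t. if k < t then u (t - k) else 0) {1..T} \<le> L2_set u {1..T}"
proof -
  have "(\<Sum>t=1..T. (if k < t then u (t - k) else 0)\<^sup>2) = (\<Sum>t\<in>{1..T} \<inter> {t. k < t}. (u (t - k))\<^sup>2)"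
    by (simp add: if_distrib[of "\<lambda>x. x\<^sup>2"] sum.inter_restrict cong: if_cong)
  also have "\<dots> = (\<Sum>t=1..T - k. (u t)\<^sup>2)"
    by (rule sum.reindex_bij_witness[of _ "\<lambda>t. t + k" "\<lambda>t. t - k"]) auto
  also have "\<dots> \<le> (\<Sum>t=1..T. (u t)\<^sup>2)"
    by (rule sum_mono2) auto
  finally show ?thesis by (simp add: L2_set_def)
qed

lemma residual_taylor:
  fixes e :: "nat \<Rightarrow> 't::finite" and f :: "nat \<Rightarrow> real ^ 'd::finite \<Rightarrow> real ^ 'd"
  assumes e: "bij_betw e {1..T} UNIV"
    and diff: "\<And>t x. 1 \<le> t \<Longrightarrow> t \<le> T \<Longrightarrow> f t differentiable (at x)"
    and "0 < L"
    and lip: "\<And>t x y. 1 < t \<Longrightarrow> t \<le> T \<Longrightarrow>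
           spectral_norm (jac (f t) x - jac (f t) y) \<le> L * norm (x - y)"
  shows "norm (residual T e f s0 (x + v) - residual T e f s0 x - jac (residual T e f s0) x *v v)
           \<le> L / 2 * (norm v)\<^sup>2"
proof -
  define X where "X = state e s0 x"
  define V where "V = state e 0 v"
  define R where "R t = f t (X (t - 1) + V (t - 1)) - f t (X (t - 1)) - jac (f t) (X (t - 1)) *v V (t - 1)" for t
  have "residual T e f s0 (x + v) - residual T e f s0 x - jac (residual T e f s0) x *v v =
      stack T e (\<lambda>t. - R t)"
  proof -
    have jac: "jac (residual T e f s0) x *v v =
        stack T e (\<lambda>t. V t - jac (f t) (X (t - 1)) *v V (t - 1))"
      unfolding V_def X_def by (rule jac_residual[OF e diff])
    show ?thesis
      unfolding jac residual_def state_add X_def[symmetric] V_def[symmetric]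
      by (simp add: stack_def vec_eq_iff R_def)
  qed
  then have "norm (residual T e f s0 (x + v) - residual T e f s0 x - jac (residual T e f s0) x *v v)
      = L2_set (\<lambda>t. norm (R t)) {1..T}"
    by (simp add: norm_stack[OF e])
  also have "\<dots> \<le> L2_set (\<lambda>t. L / 2 * (norm (V (t - 1)))\<^sup>2) {1..T}"
  proof (rule L2_set_mono)
    fix t assume t: "t \<in> {1..T}"
    show "norm (R t) \<le> L / 2 * (norm (V (t - 1)))\<^sup>2"
    proof (cases "t = 1")
      case True
      then show ?thesis by (simp add: R_def V_def state_def)
    next
      case False
      show ?thesis
        unfolding R_def
      proof (rule taylor_remainder_lipschitz_derivative)
        show "(f t has_derivative (\<lambda>v. jac (f t) y *v v)) (at y)" for y
          using t diff by (intro has_derivative_jac) auto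
        show "norm (jac (f t) y *v w - jac (f t) z *v w) \<le> L * norm (y - z) * norm w" for y z w
        proof -
          have "norm ((jac (f t) y - jac (f t) z) *v w) \<le>
              spectral_norm (jac (f t) y - jac (f t) z) * norm w"
            unfolding spectral_norm_def by (rule onorm) simp
          also have "\<dots> \<le> L * norm (y - z) * norm w"
            using t False by (intro mult_right_mono lip) auto
          finally show ?thesis by (simp add: matrix_vector_mult_diff_rdistrib)
        qed
      qed
    qed
  qed simp
  also have "\<dots> = L / 2 * L2_set (\<lambda>t. (norm (V (t - 1)))\<^sup>2) {1..T}"
    using \<open>0 < L\<close> by (intro L2_set_right_distrib[symmetric]) simp
  also have "\<dots> \<le> L / 2 * (L2_set (\<lambda>t. norm (V (t - 1))) {1..T})\<^sup>2"
    using \<open>0 < L\<close> by (intro mult_left_mono L2_set_power2_le) auto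
  also have "\<dots> \<le> L / 2 * (norm v)\<^sup>2"
  proof -
    have "L2_set (\<lambda>t. norm (V (t - 1))) {1..T} \<le> L2_set (\<lambda>t. norm (V t)) {1..T}"
    proof -
      have "L2_set (\<lambda>t. norm (V (t - 1))) {1..T} =
          L2_set (\<lambda>t. if 1 < t then norm (V (t - 1)) else 0) {1..T}"
        by (rule L2_set_cong) (auto simp: V_def state_def)
      then show ?thesis using L2_set_shift_le[of 1 "\<lambda>t. norm (V t)" T] by simp
    qed
    also have "\<dots> = norm v"
      unfolding V_def by (rule norm_eq_L2_set_state[OF e, symmetric])
    finally show ?thesis
      using \<open>0 < L\<close> by (intro mult_left_mono power_mono) auto
  qed
  finally show ?thesis .
qed

section \<open>The smallest singular value of the residual Jacobian\<close>

text \<open>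
  The discrete variation of constants formula: the input \<open>W (t - k)\<close> reaches time \<open>t\<close> through the \<open>k\<close>
  transition matrices \<open>A (t - k + 1), ..., A t\<close>.
\<close>

lemma forward_substitution:
  fixes A :: "nat \<Rightarrow> real ^ 'd ^ 'd::finite"
  assumes "V 0 = 0" and rec: "\<And>t. 1 \<le> t \<Longrightarrow> t \<le> T \<Longrightarrow> V t = A t *v V (t - 1) + W t"
  shows "t \<le> T \<Longrightarrow> V t = (\<Sum>k<t. mat_prod A (t - k + 1) k *v W (t - k))"
proof (induction t)
  case (Suc t)
  have "A (Suc t) *v (mat_prod A (t - k + 1) k *v W (t - k)) =
      mat_prod A (Suc t - Suc k + 1) (Suc k) *v W (Suc t - Suc k)" if "k < t" for k
    using that by (simp add: matrix_vector_mul_assoc)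
  moreover have "V t = (\<Sum>k<t. mat_prod A (t - k + 1) k *v W (t - k))"
    using Suc by simp
  ultimately have "A (Suc t) *v V t =
      (\<Sum>k<t. mat_prod A (Suc t - Suc k + 1) (Suc k) *v W (Suc t - Suc k))"
    by (simp only: linear_sum[OF matrix_vector_mul_linear]) (intro sum.cong refl, simp only: lessThan_iff)
  with rec[of "Suc t"] Suc.prems show ?case
    unfolding sum.lessThan_Suc_shift by (simp add: add.commute)
qed (simp add: assms)

lemma L2_set_sum_le:
  "finite K \<Longrightarrow> L2_set (\<lambda>t. \<Sum>k\<in>K. h k t) S \<le> (\<Sum>k\<in>K. L2_set (h k) S)"
proof (induction K rule: finite_induct)
  case (insert k K)
  then show ?case
    using L2_set_triangle_ineq[of "h k" "\<lambda>t. \<Sum>k\<in>K. h k t" S] by simp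
qed (simp add: L2_set_def)

text \<open>
  Young's inequality \<open>\<ell>\<^sup>1 * \<ell>\<^sup>2 \<subseteq> \<ell>\<^sup>2\<close> for causal convolutions: the convolution is a combination of delayed
  copies of \<open>u\<close> with weights \<open>g k\<close>, and each copy has norm at most that of \<open>u\<close>.
\<close>

lemma L2_set_convolution_le:
  fixes g u :: "nat \<Rightarrow> real"
  assumes "\<And>k. 0 \<le> g k"
  shows "L2_set (\<lambda>t. \<Sum>k<t. g k * u (t - k)) {1..T} \<le> (\<Sum>k<T. g k) * L2_set u {1..T}"
proof -
  have "(\<Sum>k<t. g k * u (t - k)) = (\<Sum>k<T. g k * (if k < t then u (t - k) else 0))"
    if "t \<le> T" for t
    using that by (intro sum.mono_neutral_cong_left) auto
  then have "L2_set (\<lambda>t. \<Sum>k<t. g k * u (t - k)) {1..T} =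
      L2_set (\<lambda>t. \<Sum>k<T. g k * (if k < t then u (t - k) else 0)) {1..T}"
    by (intro L2_set_cong) auto
  also have "\<dots> \<le> (\<Sum>k<T. L2_set (\<lambda>t. g k * (if k < t then u (t - k) else 0)) {1..T})"
    by (rule L2_set_sum_le) simp
  also have "\<dots> = (\<Sum>k<T. g k * L2_set (\<lambda>t. if k < t then u (t - k) else 0) {1..T})"
    using assms by (simp add: L2_set_right_distrib)
  also have "\<dots> \<le> (\<Sum>k<T. g k * L2_set u {1..T})"
    using assms by (intro sum_mono mult_left_mono L2_set_shift_le)
  finally show ?thesis by (simp add: sum_distrib_right)
qed

text \<open>
  For a vector \<open>v\<close> attaining the smallest singular value and its image \<open>w\<close>, the blocks of \<open>v\<close> are
  recovered from those of \<open>w\<close> by forward substitution, so \<open>norm v \<le> (\<Sum>k<T. g k) * norm w\<close>.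
\<close>

lemma sigma_min_jac_residual_ge:
  fixes e :: "nat \<Rightarrow> 't::finite" and f :: "nat \<Rightarrow> real ^ 'd::finite \<Rightarrow> real ^ 'd"
  assumes e: "bij_betw e {1..T} UNIV"
    and diff: "\<And>t x. 1 \<le> t \<Longrightarrow> t \<le> T \<Longrightarrow> f t differentiable (at x)"
    and g: "\<And>k. 0 \<le> g k"
    and bound: "\<And>t k. 1 < t \<Longrightarrow> t + k - 1 \<le> T \<Longrightarrow>
      spectral_norm (mat_prod (\<lambda>t. jac (f t) (state e s0 x (t - 1))) t k) \<le> g k"
  shows "1 \<le> (\<Sum>k<T. g k) * sigma_min (jac (residual T e f s0) x)"
proof -
  define A where "A = (\<lambda>t. jac (f t) (state e s0 x (t - 1)))"
  obtain v where v: "v \<noteq> 0"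
    "norm (jac (residual T e f s0) x *v v) = sigma_min (jac (residual T e f s0) x) * norm v"
    using sigma_min_attained(3) by blast
  define w where "w = jac (residual T e f s0) x *v v"
  define V where "V = state e 0 v"
  define W where "W = state e 0 w"
  have w: "w = stack T e (\<lambda>t. V t - A t *v V (t - 1))"
    unfolding w_def V_def A_def by (rule jac_residual[OF e diff])
  have rec: "V t = A t *v V (t - 1) + W t" if "1 \<le> t" "t \<le> T" for t
  proof -
    have "W t = V t - A t *v V (t - 1)"
      unfolding W_def w by (rule state_stack[OF e]) (use that in simp)
    then show ?thesis by simp
  qed
  have V0: "V 0 = 0" by (simp add: V_def state_def)
  have summand_le: "norm (mat_prod A (t - k + 1) k *v W (t - k)) \<le> g k * norm (W (t - k))"
    if "k < t" "t \<le> T" for t k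
  proof -
    have "norm (mat_prod A (t - k + 1) k *v W (t - k)) \<le>
        spectral_norm (mat_prod A (t - k + 1) k) * norm (W (t - k))"
      unfolding spectral_norm_def by (rule onorm) simp
    also have "\<dots> \<le> g k * norm (W (t - k))"
      unfolding A_def using that by (intro mult_right_mono bound) auto
    finally show ?thesis .
  qed
  have V_le: "norm (V t) \<le> (\<Sum>k<t. g k * norm (W (t - k)))" if "t \<le> T" for t
  proof -
    have "V t = (\<Sum>k<t. mat_prod A (t - k + 1) k *v W (t - k))"
      by (rule forward_substitution[OF V0 rec that])
    then show ?thesis
      using that summand_le by (simp only:) (intro order.trans[OF norm_sum] sum_mono, simp only: lessThan_iff)
  qed
  have "norm v = L2_set (\<lambda>t. norm (V t)) {1..T}"
    unfolding V_def by (rule norm_eq_L2_set_state[OF e])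
  also have "\<dots> \<le> L2_set (\<lambda>t. \<Sum>k<t. g k * norm (W (t - k))) {1..T}"
    using V_le by (intro L2_set_mono) auto
  also have "\<dots> \<le> (\<Sum>k<T. g k) * L2_set (\<lambda>t. norm (W t)) {1..T}"
    by (rule L2_set_convolution_le[OF g])
  also have "L2_set (\<lambda>t. norm (W t)) {1..T} = norm w"
    unfolding W_def by (rule norm_eq_L2_set_state[OF e, symmetric])
  finally have "1 * norm v \<le> (\<Sum>k<T. g k) * sigma_min (jac (residual T e f s0) x) * norm v"
    using v(2) by (simp add: w_def mult.assoc)
  then show ?thesis using v(1) by (simp only: mult_le_cancel_right) auto
qed

section \<open>The basin of quadratic convergence\<close>

theorem theorem5:
  fixes T :: nat
    and e :: "nat \<Rightarrow> 't::finite"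
    and s0 :: "real ^ 'd::finite"
    and f :: "nat \<Rightarrow> real ^ 'd \<Rightarrow> real ^ 'd"
    and L \<mu> :: real
    and r :: "real ^ ('t \<times> 'd) \<Rightarrow> real ^ ('t \<times> 'd)"
    and s :: "nat \<Rightarrow> real ^ ('t \<times> 'd)"
  assumes "1 \<le> T"
    and "bij_betw e {1..T} UNIV"
    and "\<And>t x. 1 \<le> t \<Longrightarrow> t \<le> T \<Longrightarrow> f t differentiable (at x)"
    and "0 < L"
    and "\<And>t x y. 1 < t \<Longrightarrow> t \<le> T \<Longrightarrow>
           spectral_norm (jac (f t) x - jac (f t) y) \<le> L * norm (x - y)"
    and "r = residual T e f s0"
    and "\<mu> = (INF x. (sigma_min (jac r x))\<^sup>2)"
    and "0 < \<mu>"
    and "deer_iterates r s"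
  shows
    "(\<forall>i. norm (r (s i)) < 2 * \<mu> / L \<longrightarrow> in_quadratic_basin L \<mu> r s i) \<and>
     (\<forall>lam a b :: real.
        lam \<noteq> 0 \<and> 1 \<le> a \<and> 0 < b \<and> b \<le> 1 \<and>
        (\<forall>t k x. 1 < t \<and> t + k - 1 \<le> T \<longrightarrow>
           b * exp (lam * real k) \<le>
             spectral_norm (mat_prod (\<lambda>t. jac (f t) (state e s0 x (t - 1))) t k) \<and>
           spectral_norm (mat_prod (\<lambda>t. jac (f t) (state e s0 x (t - 1))) t k) \<le>
             a * exp (lam * real k)) \<longrightarrow>
        (\<forall>i. norm (r (s i)) < 2 / (a\<^sup>2 * L) * ((exp lam - 1) / (exp (lam * real T) - 1))\<^sup>2 \<longrightarrow>
             in_quadratic_basin L \<mu> r s i))"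
proof (intro conjI allI impI)
  have basin: "in_quadratic_basin L \<mu> r s i" if "norm (r (s i)) < 2 * \<mu> / L" for i
  proof (rule in_quadratic_basinI[where r = r and s = s, OF _ assms(4,8) that])
    fix j
    have "bdd_below (range (\<lambda>x. (sigma_min (jac r x))\<^sup>2))"
      by (intro bdd_belowI[of _ 0]) auto
    then have "\<mu> \<le> (sigma_min (jac r (s j)))\<^sup>2"
      unfolding assms(7) by (rule cINF_lower) simp
    then have "norm (r (s j - matrix_inv (jac r (s j)) *v r (s j))) \<le>
        L / (2 * \<mu>) * (norm (r (s j)))\<^sup>2"
      using assms(4,8) unfolding assms(6)
      by (intro newton_step_quadratic residual_taylor[OF assms(2-5)])
    then show "norm (r (s (Suc j))) \<le> L / (2 * \<mu>) * (norm (r (s j)))\<^sup>2"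
      using assms(9) by (simp add: deer_iterates_def)
  qed
  then show "in_quadratic_basin L \<mu> r s i" if "norm (r (s i)) < 2 * \<mu> / L" for i
    using that .
  fix lam a b :: real and i
  assume growth: "lam \<noteq> 0 \<and> 1 \<le> a \<and> 0 < b \<and> b \<le> 1 \<and>
        (\<forall>t k x. 1 < t \<and> t + k - 1 \<le> T \<longrightarrow>
           b * exp (lam * real k) \<le>
             spectral_norm (mat_prod (\<lambda>t. jac (f t) (state e s0 x (t - 1))) t k) \<and>
           spectral_norm (mat_prod (\<lambda>t. jac (f t) (state e s0 x (t - 1))) t k) \<le>
             a * exp (lam * real k))"
    and small: "norm (r (s i)) < 2 / (a\<^sup>2 * L) * ((exp lam - 1) / (exp (lam * real T) - 1))\<^sup>2"
  define G where "G = (\<Sum>k<T. exp lam ^ k)"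
  have G: "G = (exp (lam * real T) - 1) / (exp lam - 1)"
    using growth geometric_sum[of "exp lam" T] unfolding G_def
    by (simp add: exp_of_nat_mult[symmetric] mult.commute)
  have "0 < G" using assms(1) by (auto simp: G_def lessThan_empty_iff intro!: sum_pos)
  have a: "0 < a" using growth by simp
  have "1 / (a * G) \<le> sigma_min (jac r x)" for x
  proof -
    have "1 \<le> (\<Sum>k<T. a * exp (lam * real k)) * sigma_min (jac r x)"
      unfolding assms(6)
      using growth by (intro sigma_min_jac_residual_ge[OF assms(2,3)]) auto
    also have "(\<Sum>k<T. a * exp (lam * real k)) = a * G"
      by (simp add: G_def sum_distrib_left exp_of_nat_mult[symmetric] mult.commute)
    finally show ?thesis using \<open>0 < G\<close> a by (simp add: field_simps)
  qed
  then have "(1 / (a * G))\<^sup>2 \<le> \<mu>"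
    unfolding assms(7) using \<open>0 < G\<close> a by (intro cINF_greatest power_mono) auto
  then have "2 / L * (1 / (a * G))\<^sup>2 \<le> 2 / L * \<mu>"
    using assms(4) by (intro mult_left_mono) auto
  moreover have "2 / (a\<^sup>2 * L) * ((exp lam - 1) / (exp (lam * real T) - 1))\<^sup>2 =
      2 / L * (1 / (a * G))\<^sup>2"
    unfolding G by (simp add: power_divide power_mult_distrib)
  ultimately show "in_quadratic_basin L \<mu> r s i"
    using small by (intro basin) simp
qed

end
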